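(* If $W_n$ is a wheel graph with $n\geq 5$, then $W_n\in\mathcal{A}(3)$, i.e., every subgraph $H$ of $W_n$ with $\Delta(H)\leq 3$ has a proper $3$-edge-coloring.
   Context: The wheel graph $W_n$ has vertex set $\{v_0,v_1,\dots,v_n\}$ and edge set $\{v_1v_2,v_2v_3,\dots,v_{n-1}v_n,v_nv_1\}\cup\{v_0v_1,\dots,v_0v_n\}$. For an integer $q\geq 2$, $\mathcal{A}(q)$ is the set of graphs $G$ such that every subgraph $H$ of $G$ with maximum degree $\Delta(H)\leq q$ has a proper $q$-edge-coloring (adjacent edges receive distinct colors). *)

theory Defs
  imports Main
begin

record 'a ugraph =
  vertices :: "'a set"
  edges :: "'a set set"

definition simple_graph :: "'a ugraph \<Rightarrow> bool" where
  "simple_graph G \<longleftrightarrow> finite (vertices G) \<and>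
     edges G \<subseteq> {{u, v} | u v. u \<in> vertices G \<and> v \<in> vertices G \<and> u \<noteq> v}"

definition subgraph_of :: "'a ugraph \<Rightarrow> 'a ugraph \<Rightarrow> bool" where
  "subgraph_of H G \<longleftrightarrow> simple_graph H \<and> vertices H \<subseteq> vertices G \<and> edges H \<subseteq> edges G"

definition degree :: "'a ugraph \<Rightarrow> 'a \<Rightarrow> nat" where
  "degree G v = card {e \<in> edges G. v \<in> e}"

(* Inserting 0 only matters for the graph without vertices. *)
definition max_degree :: "'a ugraph \<Rightarrow> nat" where
  "max_degree G = Max (insert 0 (degree G ` vertices G))"

definition proper_edge_coloring :: "'a ugraph \<Rightarrow> nat \<Rightarrow> ('a set \<Rightarrow> nat) \<Rightarrow> bool" where
  "proper_edge_coloring G q c \<longleftrightarrow>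
     (\<forall>e \<in> edges G. c e < q) \<and>
     (\<forall>e \<in> edges G. \<forall>f \<in> edges G. e \<noteq> f \<and> e \<inter> f \<noteq> {} \<longrightarrow> c e \<noteq> c f)"

definition edge_colorable :: "'a ugraph \<Rightarrow> nat \<Rightarrow> bool" where
  "edge_colorable G q \<longleftrightarrow> (\<exists>c. proper_edge_coloring G q c)"

definition class_A :: "nat \<Rightarrow> 'a ugraph set" where
  "class_A q = {G. simple_graph G \<and>
     (\<forall>H. subgraph_of H G \<and> max_degree H \<le> q \<longrightarrow> edge_colorable H q)}"

(* The wheel with hub v 0 and rim v 1, ..., v n; meaningful only when v is
   injective on {0..n} and n is at least 3. *)
definition wheel :: "(nat \<Rightarrow> 'a) \<Rightarrow> nat \<Rightarrow> 'a ugraph" where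
  "wheel v n = \<lparr> vertices = v ` {0..n},
     edges = {{v i, v (i + 1)} | i. 1 \<le> i \<and> i < n} \<union> {{v n, v 1}}
             \<union> {{v 0, v i} | i. 1 \<le> i \<and> i \<le> n} \<rparr>"

end

theory Submission
  imports Defs
begin

text \<open>
  A subgraph of maximum degree at most 3 has at most three spokes, so it suffices to colour the
  whole rim together with exactly three spokes, which get the colours 0, 1, 2. These spokes cut
  the rim into three segments. A path with \<open>m\<close> edges can be properly 3-coloured with prescribed
  first and last colours \<open>x\<close> and \<open>y\<close> unless \<open>m = 1\<close> and \<open>x \<noteq> y\<close>, or \<open>m = 2\<close> and \<open>x = y\<close>.
  At each of the three spoke ends there are two ways to distribute the two remaining colours over
  the two rim edges; call the end aligned if each of these rim edges gets the colour that is
  also available at the other end of its segment. Then a segment of length 1 needs both ends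
  aligned, and a segment of length 2 needs an end that is not. Aligning exactly the ends of the
  segments of length 1 fails only for the lengths 1, 1, 2, which is excluded by \<open>n \<ge> 5\<close>.
\<close>

lemma exists_proper_word:
  assumes "3 \<le> card C" "x \<in> C" "y \<in> C" "0 < m" "m = 1 \<Longrightarrow> x = y" "m = 2 \<Longrightarrow> x \<noteq> y"
  shows "\<exists>w. length w = m \<and> set w \<subseteq> C \<and> successively (\<noteq>) w \<and> hd w = x \<and> last w = y"
  using assms
proof (induction m arbitrary: x)
  case 0
  then show ?case by simp
next
  case (Suc m)
  consider "m = 0" | "m = 1" | "m \<ge> 2" by linarith
  then show ?case
  proof cases
    case 1
    then show ?thesis
      using Suc.prems by (intro exI[of _ "[x]"]) simp
  next
    case 2
    then show ?thesis
      using Suc.prems by (intro exI[of _ "[x, y]"]) simp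
  next
    case 3
    have "card {x, y} \<le> 2" by (simp add: card_insert_if)
    then have "\<not> C \<subseteq> {x, y}"
      using card_mono[of "{x, y}" C] Suc.prems(1) by auto
    then obtain z where z: "z \<in> C" "z \<noteq> x" "z \<noteq> y" by blast
    then obtain w where w: "length w = m" "set w \<subseteq> C" "successively (\<noteq>) w" "hd w = z" "last w = y"
      using Suc.IH[of z] 3 Suc.prems by auto
    moreover have "w \<noteq> []" using w(1) 3 by auto
    ultimately show ?thesis
      using z(2) Suc.prems(2) by (intro exI[of _ "x # w"]) (simp add: successively_Cons)
  qed
qed

text \<open>
  The colours of a segment between spokes of colours \<open>\<alpha>\<close> and \<open>\<beta>\<close>; \<open>A\<close> and \<open>B\<close> tell whether its
  two ends are aligned, \<open>\<gamma>\<close> being the colour available at both.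
\<close>

lemma exists_segment_word:
  assumes "distinct [\<alpha>, \<beta>, \<gamma>]" "0 < m" "m = 1 \<Longrightarrow> A \<and> B" "m = 2 \<Longrightarrow> \<not> (A \<and> B)"
  obtains w where "length w = m" "set w \<subseteq> {\<alpha>, \<beta>, \<gamma>}" "successively (\<noteq>) w"
    "hd w = (if A then \<gamma> else \<beta>)" "last w = (if B then \<gamma> else \<alpha>)"
proof -
  have "\<exists>w. length w = m \<and> set w \<subseteq> {\<alpha>, \<beta>, \<gamma>} \<and> successively (\<noteq>) w
      \<and> hd w = (if A then \<gamma> else \<beta>) \<and> last w = (if B then \<gamma> else \<alpha>)"
    using assms by (intro exists_proper_word) auto
  then show ?thesis using that by blast
qed

lemma nth_append_last: "xs \<noteq> [] \<Longrightarrow> (xs @ ys) ! (length xs - 1) = last xs"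
  by (simp add: nth_append last_conv_nth)

lemma nth_append_hd: "ys \<noteq> [] \<Longrightarrow> (xs @ ys) ! length xs = hd ys"
  by (simp add: nth_append hd_conv_nth)

lemma successively_cyclic_nth:
  assumes "successively P w" "P (last w) (hd w)" "i < length w"
  shows "P (w ! i) (w ! (Suc i mod length w))"
proof (cases "Suc i < length w")
  case True
  then show ?thesis using assms(1) by (simp add: successively_conv_nth)
next
  case False
  then have "length w = Suc i" using assms(3) by simp
  moreover from this have "w \<noteq> []" by auto
  ultimately show ?thesis using assms(2) by (simp add: last_conv_nth hd_conv_nth)
qed

text \<open>
  The rim vertices are numbered cyclically by \<open>0, \<dots>, n - 1\<close>; \<open>r i\<close> is the colour of the rim edge
  from \<open>i\<close> to its successor, and \<open>s i\<close> that of the spoke at \<open>i\<close>, for the spokes in \<open>S\<close> only.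
\<close>

definition wheel_coloring :: "nat \<Rightarrow> nat \<Rightarrow> nat set \<Rightarrow> (nat \<Rightarrow> nat) \<Rightarrow> (nat \<Rightarrow> nat) \<Rightarrow> bool" where
  "wheel_coloring q n S r s \<longleftrightarrow>
     (\<forall>i<n. r i < q) \<and> (\<forall>i\<in>S. s i < q) \<and> inj_on s S \<and>
     (\<forall>i<n. r i \<noteq> r (Suc i mod n)) \<and> (\<forall>i\<in>S. r i \<noteq> s i) \<and>
     (\<forall>i<n. Suc i mod n \<in> S \<longrightarrow> r i \<noteq> s (Suc i mod n))"

lemma wheel_coloring_of_segments:
  assumes nonempty: "xs \<noteq> []" "ys \<noteq> []" "zs \<noteq> []"
    and colors: "set (xs @ ys @ zs) \<subseteq> {..<q}"
    and proper: "successively (\<noteq>) xs" "successively (\<noteq>) ys" "successively (\<noteq>) zs"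
    and positions: "b = length xs" "c = length (xs @ ys)" "n = length (xs @ ys @ zs)"
    and spokes: "inj_on s {0, b, c}" "s ` {0, b, c} \<subseteq> {..<q}"
    and meet: "distinct [last zs, s 0, hd xs]" "distinct [last xs, s b, hd ys]"
      "distinct [last ys, s c, hd zs]"
  shows "wheel_coloring q n {0, b, c} ((!) (xs @ ys @ zs)) s"
proof -
  let ?w = "xs @ ys @ zs"
  have order: "0 < b" "b < c" "c < n" using nonempty positions by auto
  have at_0: "?w ! (n - 1) = last zs" "?w ! 0 = hd xs"
    using nonempty positions(3) last_conv_nth[of ?w] hd_conv_nth[of ?w] by simp_all
  have at_b: "?w ! (b - 1) = last xs" "?w ! b = hd ys"
    using nth_append_last[of xs "ys @ zs"] nth_append_hd[of "ys @ zs" xs] nonempty positions(1)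
    by simp_all
  have at_c: "?w ! (c - 1) = last ys" "?w ! c = hd zs"
    using nth_append_last[of "xs @ ys" zs] nth_append_hd[of zs "xs @ ys"] nonempty positions(2)
    by simp_all
  have less: "?w ! i < q" if "i < n" for i
    using that colors positions(3) nth_mem by blast
  have "successively (\<noteq>) ?w" "last ?w \<noteq> hd ?w"
    using nonempty proper meet by (auto simp: successively_append_iff)
  then have cyclic: "?w ! i \<noteq> ?w ! (Suc i mod n)" if "i < n" for i
    using that successively_cyclic_nth[of "(\<noteq>)" ?w i] positions(3) by simp
  have after: "?w ! i \<noteq> s i" if "i \<in> {0, b, c}" for i
    using that meet at_0(2) at_b(2) at_c(2) by auto
  have before: "?w ! i \<noteq> s (Suc i mod n)" if "i < n" "Suc i mod n \<in> {0, b, c}" for i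
  proof -
    have "Suc i mod n = 0 \<and> i = n - 1 \<or> Suc i mod n = b \<and> i = b - 1
        \<or> Suc i mod n = c \<and> i = c - 1"
      using that order by (cases "Suc i = n") auto
    then show ?thesis using meet at_0(1) at_b(1) at_c(1) by auto
  qed
  show ?thesis
    using less cyclic after before spokes by (simp add: wheel_coloring_def)
qed

lemma exists_three_spoke_coloring:
  assumes "0 < b" "b < c" "c < n" "5 \<le> n"
  shows "\<exists>r s. wheel_coloring 3 n {0, b, c} r s"
proof -
  define k l m where "k = b" and "l = c - b" and "m = n - c"
  note lengths = k_def l_def m_def
  define A B C where "A \<longleftrightarrow> m = 1 \<or> k = 1" and "B \<longleftrightarrow> k = 1 \<or> l = 1" and "C \<longleftrightarrow> l = 1 \<or> m = 1"
  note aligned = A_def B_def C_def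
  have pos: "0 < k" "0 < l" "0 < m" and sum: "5 \<le> k + l + m"
    using assms by (auto simp: lengths)
  obtain xs :: "nat list" where xs: "length xs = k" "set xs \<subseteq> {0, 1, 2}" "successively (\<noteq>) xs"
    "hd xs = (if A then 2 else 1)" "last xs = (if B then 2 else 0)"
    by (rule exists_segment_word[of "0 :: nat" 1 2 k A B]) (use pos sum in \<open>auto simp: aligned\<close>)
  obtain ys :: "nat list" where ys: "length ys = l" "set ys \<subseteq> {1, 2, 0}" "successively (\<noteq>) ys"
    "hd ys = (if B then 0 else 2)" "last ys = (if C then 0 else 1)"
    by (rule exists_segment_word[of "1 :: nat" 2 0 l B C]) (use pos sum in \<open>auto simp: aligned\<close>)
  obtain zs :: "nat list" where zs: "length zs = m" "set zs \<subseteq> {2, 0, 1}" "successively (\<noteq>) zs"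
    "hd zs = (if C then 1 else 0)" "last zs = (if A then 1 else 2)"
    by (rule exists_segment_word[of "2 :: nat" 0 1 m C A]) (use pos sum in \<open>auto simp: aligned\<close>)
  define s :: "nat \<Rightarrow> nat" where "s i = (if i = 0 then 0 else if i = b then 1 else 2)" for i
  have s: "s 0 = 0" "s b = 1" "s c = 2" using assms by (auto simp: s_def)
  have "wheel_coloring 3 n {0, b, c} ((!) (xs @ ys @ zs)) s"
  proof (rule wheel_coloring_of_segments)
    show "xs \<noteq> []" "ys \<noteq> []" "zs \<noteq> []" using pos xs(1) ys(1) zs(1) by auto
    show "set (xs @ ys @ zs) \<subseteq> {..<3}" using xs(2) ys(2) zs(2) by auto
    show "b = length xs" "c = length (xs @ ys)" "n = length (xs @ ys @ zs)"
      using assms xs(1) ys(1) zs(1) by (auto simp: lengths)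
    show "inj_on s {0, b, c}" "s ` {0, b, c} \<subseteq> {..<3}" using s by (auto simp: inj_on_def)
  qed (use xs ys zs s in auto)
  then show ?thesis by blast
qed

lemma wheel_coloring_rotate:
  fixes k n :: nat
  defines "\<rho> \<equiv> \<lambda>i. (i + k) mod n"
  assumes coloring: "wheel_coloring q n S r s" and T: "inj_on \<rho> T" "\<rho> ` T \<subseteq> S"
  shows "wheel_coloring q n T (r \<circ> \<rho>) (s \<circ> \<rho>)"
proof -
  have Suc_rotate: "\<rho> (Suc i mod n) = Suc (\<rho> i) mod n" for i
    by (simp add: \<rho>_def mod_simps)
  have less: "\<rho> i < n" if "i < n" for i
    using that by (auto simp: \<rho>_def)
  have inj: "inj_on (s \<circ> \<rho>) T"
    using coloring T by (auto simp: wheel_coloring_def intro: comp_inj_on inj_on_subset)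
  have before: "r (\<rho> i) \<noteq> s (\<rho> (Suc i mod n))" if "i < n" "Suc i mod n \<in> T" for i
  proof -
    have "Suc (\<rho> i) mod n \<in> S" using T(2) that(2) Suc_rotate[of i] by auto
    then show ?thesis
      using coloring less[OF that(1)] by (simp add: wheel_coloring_def Suc_rotate)
  qed
  show ?thesis
    using coloring T(2) less inj before
    by (auto simp: wheel_coloring_def Suc_rotate image_subset_iff)
qed

lemma card_3_sorted:
  fixes T :: "'a :: linorder set"
  assumes "card T = 3"
  obtains a b c where "T = {a, b, c}" "a < b" "b < c"
proof -
  have "length (sorted_list_of_set T) = Suc (Suc (Suc 0))" using assms by simp
  then obtain a b c where sorted: "sorted_list_of_set T = [a, b, c]"
    by (auto simp only: length_Suc_conv length_0_conv)
  have "finite T" using assms card_ge_0_finite[of T] by simp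
  then have "T = {a, b, c}"
    using sorted set_sorted_list_of_set[of T] by simp
  moreover have "a < b" "b < c"
    using strict_sorted_list_of_set[of T] sorted by auto
  ultimately show ?thesis by (rule that)
qed

lemma exists_wheel_coloring:
  assumes "T \<subseteq> {..<n}" "card T = 3" "5 \<le> n"
  shows "\<exists>r s. wheel_coloring 3 n T r s"
proof -
  obtain a b c where T: "T = {a, b, c}" "a < b" "b < c"
    using assms(2) by (rule card_3_sorted)
  have "c < n" using assms(1) T(1) by simp
  then have "b - a < c - a" "c - a < n" using T(2,3) by auto
  then obtain r s where coloring: "wheel_coloring 3 n {0, b - a, c - a} r s"
    using exists_three_spoke_coloring[of "b - a" "c - a" n] T(2) assms(3) by auto
  define \<rho> where "\<rho> i = (i + (n - a)) mod n" for i
  have rotate: "\<rho> i = i - a" if "i \<in> T" for i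
  proof -
    have "i + (n - a) = n + (i - a)" "i - a < n" using that T \<open>c < n\<close> by auto
    then show ?thesis by (simp add: \<rho>_def)
  qed
  have "inj_on \<rho> T" using T by (auto simp: inj_on_def rotate)
  moreover have "\<rho> ` T \<subseteq> {0, b - a, c - a}" using T(1) by (auto simp: rotate)
  ultimately show ?thesis
    using wheel_coloring_rotate[OF coloring, of "n - a" T] unfolding \<rho>_def by blast
qed

lemma simple_graph_finite_edges:
  assumes "simple_graph G"
  shows "finite (edges G)"
proof (rule finite_subset)
  show "edges G \<subseteq> Pow (vertices G)" using assms by (auto simp: simple_graph_def)
  show "finite (Pow (vertices G))" using assms by (simp add: simple_graph_def)
qed

lemma degree_le_max_degree:
  assumes "simple_graph G"
  shows "degree G x \<le> max_degree G"
proof (cases "x \<in> vertices G")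
  case True
  then show ?thesis
    using assms by (auto simp: max_degree_def simple_graph_def intro!: Max_ge)
next
  case False
  then have "{e \<in> edges G. x \<in> e} = {}" using assms by (auto simp: simple_graph_def)
  then show ?thesis by (simp only: degree_def card.empty)
qed

locale wheel_graph =
  fixes v :: "nat \<Rightarrow> 'a" and n :: nat
  assumes inj: "inj_on v {0..n}" and three_le: "3 \<le> n"
begin

abbreviation hub :: 'a where
  "hub \<equiv> v 0"

definition rim :: "nat \<Rightarrow> 'a" where
  "rim i = v (Suc i)"

definition rim_edge :: "nat \<Rightarrow> 'a set" where
  "rim_edge i = {rim i, rim (Suc i mod n)}"

definition spoke :: "nat \<Rightarrow> 'a set" where
  "spoke i = {hub, rim i}"

lemma rim_eq_iff [simp]: "i < n \<Longrightarrow> j < n \<Longrightarrow> rim i = rim j \<longleftrightarrow> i = j"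
  by (simp add: rim_def inj_on_eq_iff[OF inj])

lemma hub_neq_rim [simp]: "i < n \<Longrightarrow> hub \<noteq> rim i" "i < n \<Longrightarrow> rim i \<noteq> hub"
  by (simp_all add: rim_def inj_on_eq_iff[OF inj])

lemma mod_n_less [simp]: "i mod n < n"
  using three_le by simp

lemma edges_wheel: "edges (wheel v n) = rim_edge ` {..<n} \<union> spoke ` {..<n}"
proof -
  have Suc_image: "{i. 1 \<le> i \<and> i \<le> m} = Suc ` {..<m}" for m
    by (auto simp: lessThan_atLeast0 atLeastLessThanSuc_atLeastAtMost)
  have "{i. 1 \<le> i \<and> i < n} = Suc ` {..<n - 1}"
    using three_le unfolding Suc_image[symmetric] by auto
  then have "{{v i, v (i + 1)} | i. 1 \<le> i \<and> i < n} = (\<lambda>i. {v i, v (i + 1)}) ` Suc ` {..<n - 1}"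
    unfolding image_Collect[symmetric] by (rule arg_cong)
  also have "\<dots> = rim_edge ` {..<n - 1}"
    unfolding image_image by (intro image_cong) (auto simp: rim_edge_def rim_def)
  finally have "{{v i, v (i + 1)} | i. 1 \<le> i \<and> i < n} = rim_edge ` {..<n - 1}" .
  moreover have "{v n, v 1} = rim_edge (n - 1)"
    using three_le by (simp add: rim_edge_def rim_def)
  moreover have "{{v 0, v i} | i. 1 \<le> i \<and> i \<le> n} = spoke ` {..<n}"
    unfolding image_Collect[symmetric] Suc_image image_image by (simp add: spoke_def rim_def)
  moreover have "{..<n} = insert (n - 1) {..<n - 1}" using three_le by auto
  ultimately show ?thesis by (auto simp: wheel_def)
qed

lemma vertices_wheel: "vertices (wheel v n) = insert hub (rim ` {..<n})"
  by (simp add: wheel_def rim_def atLeast0AtMost atMost_Suc_eq_insert_0 image_image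
      lessThan_Suc_atMost[symmetric] lessThan_Suc_eq_insert_0)

lemma simple_graph_wheel: "simple_graph (wheel v n)"
proof -
  let ?V = "insert hub (rim ` {..<n})"
  have "rim i \<noteq> rim (Suc i mod n)" if "i < n" for i
    using that three_le by (simp add: mod_Suc)
  then have "\<exists>x y. e = {x, y} \<and> x \<in> ?V \<and> y \<in> ?V \<and> x \<noteq> y"
    if "e \<in> rim_edge ` {..<n} \<union> spoke ` {..<n}" for e
    using that unfolding rim_edge_def spoke_def by fastforce
  then show ?thesis
    unfolding simple_graph_def edges_wheel vertices_wheel by blast
qed

lemma inj_on_spoke: "inj_on spoke {..<n}"
  by (auto simp: inj_on_def spoke_def doubleton_eq_iff)

lemma inj_on_rim_edge: "inj_on rim_edge {..<n}"
proof (rule inj_onI)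
  fix i j assume less: "i \<in> {..<n}" "j \<in> {..<n}" and "rim_edge i = rim_edge j"
  then have "i = j \<or> i = Suc j mod n \<and> j = Suc i mod n"
    by (auto simp: rim_edge_def doubleton_eq_iff)
  then show "i = j"
    using three_le less by (auto simp: mod_Suc split: if_splits)
qed

lemma rim_edge_not_spoke: "i < n \<Longrightarrow> rim_edge i \<notin> spoke ` {..<n}"
  by (auto simp: rim_edge_def spoke_def doubleton_eq_iff)

lemma rim_edges_meet:
  assumes "i < n" "j < n" "rim_edge i \<inter> rim_edge j \<noteq> {}"
  shows "i = j \<or> j = Suc i mod n \<or> i = Suc j mod n"
  using assms by (auto simp: rim_edge_def mod_Suc split: if_splits)

lemma rim_edge_meets_spoke:
  assumes "i < n" "j < n" "rim_edge i \<inter> spoke j \<noteq> {}"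
  shows "j = i \<or> j = Suc i mod n"
  using assms by (auto simp: rim_edge_def spoke_def)

definition edge_coloring :: "(nat \<Rightarrow> nat) \<Rightarrow> (nat \<Rightarrow> nat) \<Rightarrow> 'a set \<Rightarrow> nat" where
  "edge_coloring r s e = (if e \<in> spoke ` {..<n} then s (the_inv_into {..<n} spoke e)
     else r (the_inv_into {..<n} rim_edge e))"

lemma edge_coloring_spoke: "i < n \<Longrightarrow> edge_coloring r s (spoke i) = s i"
  by (simp add: edge_coloring_def the_inv_into_f_f inj_on_spoke)

lemma edge_coloring_rim_edge: "i < n \<Longrightarrow> edge_coloring r s (rim_edge i) = r i"
  by (simp add: edge_coloring_def the_inv_into_f_f inj_on_rim_edge rim_edge_not_spoke)

lemma proper_edge_coloring_subgraph:
  assumes rim_and_spokes: "edges H \<subseteq> edges (wheel v n)" "{i. i < n \<and> spoke i \<in> edges H} \<subseteq> S"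
    and coloring: "wheel_coloring q n S r s"
  shows "proper_edge_coloring H q (edge_coloring r s)"
proof -
  let ?c = "edge_coloring r s"
  note color = edge_coloring_rim_edge edge_coloring_spoke
  have edge_cases: "(\<exists>i<n. e = rim_edge i) \<or> (\<exists>i<n. i \<in> S \<and> e = spoke i)"
    if "e \<in> edges H" for e
    using that rim_and_spokes by (force simp: edges_wheel)
  have rim_rim: "?c (rim_edge i) \<noteq> ?c (rim_edge j)"
    if "i < n" "j < n" "i \<noteq> j" "rim_edge i \<inter> rim_edge j \<noteq> {}" for i j
    using rim_edges_meet[OF that(1,2,4)] that coloring
    by (auto simp: color wheel_coloring_def)
  have rim_spoke: "?c (rim_edge i) \<noteq> ?c (spoke j)"
    if "i < n" "j < n" "j \<in> S" "rim_edge i \<inter> spoke j \<noteq> {}" for i j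
    using rim_edge_meets_spoke[OF that(1,2,4)] that coloring
    by (auto simp: color wheel_coloring_def)
  have spoke_spoke: "?c (spoke i) \<noteq> ?c (spoke j)"
    if "i < n" "j < n" "i \<in> S" "j \<in> S" "i \<noteq> j" for i j
    using that coloring by (auto simp: color wheel_coloring_def dest: inj_onD)
  have "?c e < q" if "e \<in> edges H" for e
    using edge_cases[OF that] coloring by (auto simp: color wheel_coloring_def)
  moreover have "?c e \<noteq> ?c f"
    if meet: "e \<in> edges H" "f \<in> edges H" "e \<noteq> f" "e \<inter> f \<noteq> {}" for e f
    using edge_cases[OF meet(1)] edge_cases[OF meet(2)]
  proof (elim disjE exE conjE)
    fix i j assume "i < n" "j < n" "e = rim_edge i" "f = rim_edge j"
    then show ?thesis using rim_rim meet(3,4) by blast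
  next
    fix i j assume "i < n" "j < n" "j \<in> S" "e = rim_edge i" "f = spoke j"
    then show ?thesis using rim_spoke meet(4) by blast
  next
    fix i j assume "j < n" "j \<in> S" "i < n" "e = spoke j" "f = rim_edge i"
    then show ?thesis using rim_spoke[of i j] meet(4) by (simp add: Int_commute)
  next
    fix i j assume "i < n" "j < n" "i \<in> S" "j \<in> S" "e = spoke i" "f = spoke j"
    then show ?thesis using spoke_spoke meet(3) by blast
  qed
  ultimately show ?thesis by (simp add: proper_edge_coloring_def)
qed

lemma card_spokes_le_max_degree:
  assumes "simple_graph H"
  shows "card {i. i < n \<and> spoke i \<in> edges H} \<le> max_degree H"
proof -
  have "card {i. i < n \<and> spoke i \<in> edges H} \<le> degree H hub"
    unfolding degree_def
  proof (rule card_inj_on_le)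
    show "inj_on spoke {i. i < n \<and> spoke i \<in> edges H}"
      using inj_on_spoke by (rule inj_on_subset) auto
    show "spoke ` {i. i < n \<and> spoke i \<in> edges H} \<subseteq> {e \<in> edges H. hub \<in> e}"
      by (auto simp: spoke_def)
    show "finite {e \<in> edges H. hub \<in> e}"
      using simple_graph_finite_edges[OF assms] by simp
  qed
  also have "\<dots> \<le> max_degree H" using assms by (rule degree_le_max_degree)
  finally show ?thesis .
qed

end

theorem proposition2p8:
  fixes v :: "nat \<Rightarrow> 'a" and n :: nat
  assumes "inj_on v {0..n}" and "n \<ge> 5"
  shows "wheel v n \<in> class_A 3"
proof -
  interpret wheel_graph v n using assms by unfold_locales auto
  have "edge_colorable H 3" if H: "subgraph_of H (wheel v n)" and deg: "max_degree H \<le> 3" for H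
  proof -
    let ?S = "{i. i < n \<and> spoke i \<in> edges H}"
    have "card ?S \<le> 3"
      using card_spokes_le_max_degree[of H] H deg by (simp add: subgraph_of_def)
    then obtain T where T: "?S \<subseteq> T" "T \<subseteq> {..<n}" "card T = 3"
      using exists_subset_between[of ?S 3 "{..<n}"] assms(2) by auto
    then obtain r s where "wheel_coloring 3 n T r s"
      using exists_wheel_coloring assms(2) by blast
    then have "proper_edge_coloring H 3 (edge_coloring r s)"
      using proper_edge_coloring_subgraph H T(1) by (simp add: subgraph_of_def)
    then show ?thesis by (auto simp: edge_colorable_def)
  qed
  then show ?thesis using simple_graph_wheel by (simp add: class_A_def)
qed

end
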